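(* ($\mathsf{ZFC}$) The axiom $\overline{\mathsf{BA}}_{\rm Lip}(\omega^\omega)$ implies $\overline{\mathsf{BA}}_{\rm Lip}(2^\omega)$.
   Context: On $\omega^\omega$ use the metric $d(x,y)=2^{-k}$ where $k$ is least with $x(k)\neq y(k)$ (and $d(x,x)=0$); $2^\omega$ carries the restricted metric. Lipschitz always means with constant $1$: $f$ is Lipschitz if for all $x,y$ in its domain and all $k<\omega$, $x\upharpoonright k=y\upharpoonright k$ implies $f(x)\upharpoonright k=f(y)\upharpoonright k$. A subset of a topological space is $\aleph_1$-dense if its intersection with every non-empty open set has size exactly $\aleph_1$. $\overline{\mathsf{BA}}_{\rm Lip}(\omega^\omega)$: for all $\aleph_1$-dense $A,B\subseteq\omega^\omega$ there is a Lipschitz $f:\omega^\omega\to\omega^\omega$ such that $f\upharpoonright A$ is a bijection from $A$ onto $B$. $\overline{\mathsf{BA}}_{\rm Lip}(2^\omega)$: for all $\aleph_1$-dense $A,B\subseteq 2^\omega$ there are countably many Lipschitz functions $f_n:2^\omega\to2^\omega$, $n<\omega$, such that $B=\bigcup_{n<\omega}f_n``A$. *)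

theory Defs
  imports "HOL-Analysis.Analysis"
begin

unbundle cardinal_syntax

definition baire_dist :: "(nat \<Rightarrow> nat) \<Rightarrow> (nat \<Rightarrow> nat) \<Rightarrow> real" where
  "baire_dist x y = (if x = y then 0 else (1/2) ^ (LEAST k. x k \<noteq> y k))"

lemma baire_dist_le_iff: "baire_dist x y \<le> (1/2) ^ k \<longleftrightarrow> (\<forall>i<k. x i = y i)"
proof (cases "x = y")
  case True
  then show ?thesis by (simp add: baire_dist_def)
next
  case False
  define m where "m = (LEAST k. x k \<noteq> y k)"
  have ex: "\<exists>k. x k \<noteq> y k"
    using False by auto
  have m: "x m \<noteq> y m"
    unfolding m_def using ex by (rule LeastI_ex)
  have below: "x i = y i" if "i < m" for i
    using not_less_Least that unfolding m_def by blast
  have "baire_dist x y \<le> (1/2) ^ k \<longleftrightarrow> k \<le> m"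
    using False by (simp add: baire_dist_def m_def power_decreasing_iff)
  also have "\<dots> \<longleftrightarrow> (\<forall>i<k. x i = y i)"
    using m below by (meson leI less_le_trans)
  finally show ?thesis .
qed

lemma baire_dist_commute: "baire_dist x y = baire_dist y x"
proof -
  have "(LEAST k. x k \<noteq> y k) = (LEAST k. y k \<noteq> x k)"
    by (rule arg_cong[where f = Least]) auto
  then show ?thesis by (simp add: baire_dist_def)
qed

lemma baire_dist_ultra: "baire_dist x z \<le> max (baire_dist x y) (baire_dist y z)"
proof (cases "x = y \<or> y = z")
  case True
  then show ?thesis by (auto simp: le_max_iff_disj)
next
  case False
  define a where "a = (LEAST k. x k \<noteq> y k)"
  define b where "b = (LEAST k. y k \<noteq> z k)"
  have a: "baire_dist x y = (1/2) ^ a" and b: "baire_dist y z = (1/2) ^ b"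
    using False by (simp_all add: baire_dist_def a_def b_def)
  have "\<forall>i<min a b. x i = z i"
    using baire_dist_le_iff[of x y a] baire_dist_le_iff[of y z b] a b by simp
  then have "baire_dist x z \<le> (1/2) ^ min a b"
    by (simp add: baire_dist_le_iff)
  also have "\<dots> \<le> max ((1/2) ^ a) ((1/2) ^ b)"
    by (simp add: min_def le_max_iff_disj)
  finally show ?thesis by (simp add: a b)
qed

lemma baire_dist_nonneg: "0 \<le> baire_dist x y"
  by (simp add: baire_dist_def)

lemma Metric_space_baire_dist: "Metric_space M baire_dist"
proof
  fix x y z
  show "0 \<le> baire_dist x y" by (rule baire_dist_nonneg)
  show "baire_dist x y = baire_dist y x" by (rule baire_dist_commute)
  show "baire_dist x y = 0 \<longleftrightarrow> x = y" by (simp add: baire_dist_def)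
  show "baire_dist x z \<le> baire_dist x y + baire_dist y z"
    using baire_dist_ultra[of x z y] baire_dist_nonneg[of x y] baire_dist_nonneg[of y z]
    by linarith
qed

definition cantor_set :: "(nat \<Rightarrow> nat) set" where
  "cantor_set = {x. \<forall>n. x n \<in> {0, 1}}"

definition baire_topology :: "(nat \<Rightarrow> nat) topology" where
  "baire_topology = Metric_space.mtopology UNIV baire_dist"

definition cantor_topology :: "(nat \<Rightarrow> nat) topology" where
  "cantor_topology = Metric_space.mtopology cantor_set baire_dist"

lemma openin_mtopology_baire_dist:
  "openin (Metric_space.mtopology M baire_dist) U \<longleftrightarrow>
     U \<subseteq> M \<and> (\<forall>x\<in>U. \<exists>k. \<forall>y\<in>M. (\<forall>i<k. x i = y i) \<longrightarrow> y \<in> U)"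
  (is "_ \<longleftrightarrow> U \<subseteq> M \<and> ?R")
proof -
  interpret Metric_space M baire_dist
    by (rule Metric_space_baire_dist)
  have "(\<exists>r>0. mball x r \<subseteq> U) \<longleftrightarrow> (\<exists>k. \<forall>y\<in>M. (\<forall>i<k. x i = y i) \<longrightarrow> y \<in> U)"
    if "x \<in> M" for x
  proof
    assume "\<exists>r>0. mball x r \<subseteq> U"
    then obtain r where r: "r > 0" "mball x r \<subseteq> U" by blast
    obtain k :: nat where "(1/2::real) ^ k < r"
      using real_arch_pow_inv[of r "1/2"] r(1) by auto
    then have "y \<in> U" if "y \<in> M" "\<forall>i<k. x i = y i" for y
      using that \<open>x \<in> M\<close> r(2) baire_dist_le_iff[of x y k] by fastforce
    then show "\<exists>k. \<forall>y\<in>M. (\<forall>i<k. x i = y i) \<longrightarrow> y \<in> U" by blast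
  next
    assume "\<exists>k. \<forall>y\<in>M. (\<forall>i<k. x i = y i) \<longrightarrow> y \<in> U"
    then obtain k where k: "\<And>y. y \<in> M \<Longrightarrow> \<forall>i<k. x i = y i \<Longrightarrow> y \<in> U" by blast
    have "mball x ((1/2) ^ k) \<subseteq> U"
    proof
      fix y assume "y \<in> mball x ((1/2) ^ k)"
      then show "y \<in> U"
        using k[of y] baire_dist_le_iff[of x y k] by simp
    qed
    then show "\<exists>r>0. mball x r \<subseteq> U"
      by (intro exI[of _ "(1/2) ^ k"]) simp
  qed
  then show ?thesis
    unfolding openin_mtopology by blast
qed

lemma topspace_baire_topology: "topspace baire_topology = UNIV"
  by (simp add: baire_topology_def Metric_space.topspace_mtopology Metric_space_baire_dist)

lemma topspace_cantor_topology: "topspace cantor_topology = cantor_set"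
  by (simp add: cantor_topology_def Metric_space.topspace_mtopology Metric_space_baire_dist)

definition aleph1_dense :: "'a topology \<Rightarrow> 'a set \<Rightarrow> bool" where
  "aleph1_dense X A \<longleftrightarrow>
     A \<subseteq> topspace X \<and> (\<forall>U. openin X U \<and> U \<noteq> {} \<longrightarrow> |A \<inter> U| =o cardSuc natLeq)"

definition lipschitz1_on :: "(nat \<Rightarrow> nat) set \<Rightarrow> ((nat \<Rightarrow> nat) \<Rightarrow> (nat \<Rightarrow> nat)) \<Rightarrow> bool" where
  "lipschitz1_on S f \<longleftrightarrow>
     (\<forall>x\<in>S. \<forall>y\<in>S. \<forall>k. (\<forall>i<k. x i = y i) \<longrightarrow> (\<forall>i<k. f x i = f y i))"

lemma lipschitz1_on_iff_dist:
  "lipschitz1_on S f \<longleftrightarrow> (\<forall>x\<in>S. \<forall>y\<in>S. baire_dist (f x) (f y) \<le> baire_dist x y)"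
proof (intro iffI ballI)
  fix x y assume "lipschitz1_on S f" "x \<in> S" "y \<in> S"
  then show "baire_dist (f x) (f y) \<le> baire_dist x y"
    unfolding lipschitz1_on_def baire_dist_le_iff[symmetric]
    by (metis baire_dist_def order.refl)
next
  assume "\<forall>x\<in>S. \<forall>y\<in>S. baire_dist (f x) (f y) \<le> baire_dist x y"
  then show "lipschitz1_on S f"
    unfolding lipschitz1_on_def baire_dist_le_iff[symmetric]
    by (meson order.trans)
qed

definition BA_Lip_baire :: bool where
  "BA_Lip_baire \<longleftrightarrow>
     (\<forall>A B. aleph1_dense baire_topology A \<and> aleph1_dense baire_topology B \<longrightarrow>
        (\<exists>f. lipschitz1_on UNIV f \<and> bij_betw f A B))"

definition BA_Lip_cantor :: bool where
  "BA_Lip_cantor \<longleftrightarrow>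
     (\<forall>A B. aleph1_dense cantor_topology A \<and> aleph1_dense cantor_topology B \<longrightarrow>
        (\<exists>f :: nat \<Rightarrow> (nat \<Rightarrow> nat) \<Rightarrow> (nat \<Rightarrow> nat).
           (\<forall>n. f n \<in> cantor_set \<rightarrow> cantor_set \<and> lipschitz1_on cantor_set (f n)) \<and>
           B = (\<Union>n. f n ` A)))"

end

theory Submission
  imports Defs "HOL-Library.Countable_Set_Type"
begin

text \<open>
  The block code \<open>\<phi>(a) = 0^(a 0) 1 0^(a 1) 1 \<dots>\<close> is a Lipschitz injection of Baire space into Cantor
  space whose range consists of the sequences with infinitely many ones, hence is co-countable.
  Given \<open>A\<close> and \<open>B\<close>, apply the axiom for Baire space to the set of all \<open>s\<close>-shifts \<open>s x\<close> of points
  \<open>x \<in> A\<close> by finite sequences \<open>s\<close> and to the preimage of \<open>B\<close> under \<open>\<phi>\<close>. If \<open>g\<close> is the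
  resulting function, the countably many maps \<open>x \<mapsto> \<phi>(g(s x))\<close> send \<open>A\<close> onto \<open>B\<close> up to a countable
  set, which constant maps cover.
\<close>

section \<open>Cardinality aleph_1 and density\<close>

text \<open>The lower bound is uncountability because \<open>cardSuc natLeq\<close> is the least
  cardinal above \<open>natLeq\<close>. The two halves are later transferred separately: upper
  bounds along images and unions, uncountability across removal of countable sets.\<close>

lemma card_of_eq_cardSuc_natLeq_iff:
  "|X| =o cardSuc natLeq \<longleftrightarrow> |X| \<le>o cardSuc natLeq \<and> uncountable X"
proof -
  have "uncountable X \<longleftrightarrow> natLeq <o |X|"
    by (metis card_of_Well_order countable_card_le_natLeq natLeq_Well_order
        not_ordLess_iff_ordLeq)
  also have "\<dots> \<longleftrightarrow> cardSuc natLeq \<le>o |X|"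
    by (intro cardSuc_ordLess_ordLeq natLeq_Card_order card_of_Card_order)
  finally show ?thesis
    by (simp add: ordIso_iff_ordLeq)
qed

text \<open>The whole space is a non-empty open set, so the upper bound holds for \<open>A\<close>
  itself; conversely it passes down to every \<open>A \<inter> U\<close>.\<close>

lemma aleph1_dense_iff:
  "aleph1_dense X A \<longleftrightarrow> A \<subseteq> topspace X \<and> |A| \<le>o cardSuc natLeq \<and>
     (\<forall>U. openin X U \<and> U \<noteq> {} \<longrightarrow> uncountable (A \<inter> U))" (is "_ \<longleftrightarrow> ?R")
  if "topspace X \<noteq> {}"
proof
  assume *: "aleph1_dense X A"
  then have "|A \<inter> topspace X| \<le>o cardSuc natLeq"
    using that unfolding aleph1_dense_def card_of_eq_cardSuc_natLeq_iff by blast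
  then show ?R
    using * unfolding aleph1_dense_def card_of_eq_cardSuc_natLeq_iff
    by (simp add: Int_absorb2)
next
  assume ?R
  then show "aleph1_dense X A"
    unfolding aleph1_dense_def card_of_eq_cardSuc_natLeq_iff
    by (meson Int_lower1 card_of_mono1 ordLeq_transitive)
qed

lemma openin_baire_cylinder:
  assumes "openin baire_topology U" "x \<in> U"
  obtains k where "{y. \<forall>i<k. x i = y i} \<subseteq> U"
proof -
  obtain k where "\<forall>y\<in>UNIV. (\<forall>i<k. x i = y i) \<longrightarrow> y \<in> U"
    using assms unfolding baire_topology_def openin_mtopology_baire_dist by fast
  then show ?thesis using that by blast
qed

lemma openin_cantor_cylinder:
  "openin cantor_topology {y \<in> cantor_set. \<forall>i<k. x i = y i}"
  unfolding cantor_topology_def openin_mtopology_baire_dist by fastforce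

lemma cantor_set_nonempty: "cantor_set \<noteq> {}"
  by (auto simp: cantor_set_def intro!: exI[of _ "\<lambda>_. 0"])

section \<open>Shifts by finite sequences\<close>

definition prepend :: "'a list \<Rightarrow> (nat \<Rightarrow> 'a) \<Rightarrow> nat \<Rightarrow> 'a" where
  "prepend s x = (\<lambda>i. if i < length s then s ! i else x (i - length s))"

lemma inj_prepend: "inj (prepend s)"
proof (rule injI, rule ext)
  fix x y :: "nat \<Rightarrow> 'a" and i
  assume "prepend s x = prepend s y"
  then have "prepend s x (i + length s) = prepend s y (i + length s)" by simp
  then show "x i = y i" by (simp add: prepend_def)
qed

lemma lipschitz1_on_prepend: "lipschitz1_on S (prepend s)"
  by (auto simp: lipschitz1_on_def prepend_def)

lemma lipschitz1_on_compose:
  assumes f: "lipschitz1_on S f" "f ` S \<subseteq> T" and g: "lipschitz1_on T g"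
  shows "lipschitz1_on S (\<lambda>x. g (f x))"
  unfolding lipschitz1_on_iff_dist
proof (intro ballI)
  fix x y assume xy: "x \<in> S" "y \<in> S"
  then have "baire_dist (g (f x)) (g (f y)) \<le> baire_dist (f x) (f y)"
    using f(2) g by (auto simp: lipschitz1_on_iff_dist)
  also have "\<dots> \<le> baire_dist x y"
    using f(1) xy by (simp add: lipschitz1_on_iff_dist)
  finally show "baire_dist (g (f x)) (g (f y)) \<le> baire_dist x y" .
qed

text \<open>Every cylinder contains the shift of all of \<open>A\<close> by its stem, and the shift
  is injective, so this copy is still uncountable. There are only countably many stems, so the union
  has size at most aleph_1.\<close>

lemma aleph1_dense_prepend:
  assumes "|A| \<le>o cardSuc natLeq" "uncountable A"
  shows "aleph1_dense baire_topology (\<Union>s. prepend s ` A)"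
  unfolding aleph1_dense_iff[of baire_topology, unfolded topspace_baire_topology, simplified]
proof (intro conjI allI impI)
  have "|UNIV :: nat list set| \<le>o natLeq"
    by (simp flip: countable_card_le_natLeq)
  then have "|UNIV :: nat list set| \<le>o cardSuc natLeq"
    using cardSuc_greater natLeq_Card_order ordLeq_ordLess_trans ordLess_imp_ordLeq by blast
  moreover have "|prepend s ` A| \<le>o cardSuc natLeq" for s
    using assms(1) card_of_image ordLeq_transitive by blast
  moreover have "infinite (Field (cardSuc natLeq))"
    unfolding cardSuc_finite[OF natLeq_Card_order] by (simp add: Field_natLeq)
  ultimately show "|\<Union>s. prepend s ` A| \<le>o cardSuc natLeq"
    by (intro card_of_UNION_ordLeq_infinite_Field cardSuc_Card_order natLeq_Card_order) auto
next
  fix U assume U: "openin baire_topology U \<and> U \<noteq> {}"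
  then obtain a where "a \<in> U" by blast
  then obtain k where k: "{y. \<forall>i<k. a i = y i} \<subseteq> U"
    using U openin_baire_cylinder by blast
  have "prepend (map a [0..<k]) ` A \<subseteq> U"
    using k by (auto simp: prepend_def)
  moreover have "uncountable (prepend (map a [0..<k]) ` A)"
    using assms(2) countable_image_inj_on inj_on_subset[OF inj_prepend] by blast
  ultimately show "uncountable ((\<Union>s. prepend s ` A) \<inter> U)"
    by (meson Int_greatest UN_upper UNIV_I countable_subset)
qed

section \<open>The block code\<close>

text \<open>This is the position of the one that closes block \<open>j\<close> (counting from 0): it
  is preceded by \<open>j\<close> ones and by the zeros of blocks 0 to \<open>j\<close>.\<close>

definition one_pos :: "(nat \<Rightarrow> nat) \<Rightarrow> nat \<Rightarrow> nat" where
  "one_pos a j = j + (\<Sum>i\<le>j. a i)"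

text \<open>Describing the code by its set of ones, instead of concatenating blocks, reduces
  questions about it to the strictly increasing sequence \<open>one_pos a\<close>.\<close>

definition block_code :: "(nat \<Rightarrow> nat) \<Rightarrow> nat \<Rightarrow> nat" where
  "block_code a n = of_bool (n \<in> range (one_pos a))"

lemma strict_mono_one_pos: "strict_mono (one_pos a)"
  by (simp add: strict_mono_Suc_iff one_pos_def)

lemma one_pos_cong: "(\<And>i. i \<le> j \<Longrightarrow> a i = b i) \<Longrightarrow> one_pos a j = one_pos b j"
  by (simp add: one_pos_def)

lemma block_code_in_cantor_set: "block_code a \<in> cantor_set"
  by (simp add: cantor_set_def block_code_def)

text \<open>The one with index \<open>j\<close> sits at a position at least \<open>j\<close>. So a
  one at position \<open>n\<close> depends only on entries of the sequence up to
  \<open>n\<close>.\<close>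

lemma lipschitz1_on_block_code: "lipschitz1_on S block_code"
proof -
  have pos: "n \<in> range (one_pos b)"
    if ab: "\<forall>i<k. a i = b i" and n: "n < k" "n \<in> range (one_pos a)" for a b k n
  proof -
    obtain j where j: "n = one_pos a j" using n by blast
    then have "j \<le> n" by (simp add: one_pos_def)
    then have "one_pos a j = one_pos b j"
      using ab n by (intro one_pos_cong) auto
    then show ?thesis using j by blast
  qed
  have "n \<in> range (one_pos a) \<longleftrightarrow> n \<in> range (one_pos b)"
    if "\<forall>i<k. a i = b i" "n < k" for a b k n
    using pos[of k a b n] pos[of k b a n] that by auto
  then show ?thesis
    by (simp add: lipschitz1_on_def block_code_def)
qed

lemma one_pos_eqD:
  assumes "\<forall>j<k. one_pos a j = one_pos b j" "j < k"
  shows "a j = b j"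
proof (cases j)
  case 0
  then show ?thesis using assms by (force simp: one_pos_def)
next
  case (Suc i)
  then have "one_pos a i = one_pos b i" "one_pos a (Suc i) = one_pos b (Suc i)"
    using assms by auto
  then show ?thesis by (simp add: one_pos_def Suc)
qed

text \<open>A local form of injectivity, giving continuity of decoding: the ones with index below
  \<open>k\<close> all lie before \<open>one_pos a k\<close>, and their positions determine the
  first \<open>k\<close> entries.\<close>

lemma block_code_eqD:
  assumes "\<forall>n < one_pos a k. block_code a n = block_code b n" "j < k"
  shows "a j = b j"
proof -
  have ran: "n \<in> range (one_pos a) \<longleftrightarrow> n \<in> range (one_pos b)" if "n < one_pos a k" for n
    using assms(1) that by (metis block_code_def of_bool_eq_iff)
  \<comment> \<open>If the first \<open>j\<close> ones of \<open>c\<close> and \<open>d\<close>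
    agree, a one of \<open>d\<close> located before its one number \<open>j\<close> has an index
    \<open>i < j\<close>. It is then also one number \<open>i\<close> of \<open>c\<close>, so it
    cannot be one number \<open>j\<close> of \<open>c\<close>.\<close>
  have not_before: False
    if l: "one_pos c j < one_pos d j" "one_pos c j \<in> range (one_pos d)"
      and eq: "\<forall>i<j. one_pos c i = one_pos d i" for c d j
  proof -
    obtain i where i: "one_pos c j = one_pos d i" using l by blast
    then have "i < j"
      using l strict_mono_less[OF strict_mono_one_pos] by metis
    then show False
      using i eq strict_mono_eq[OF strict_mono_one_pos] by (metis less_irrefl)
  qed
  have "one_pos a j = one_pos b j" if "j < k" for j
    using that
  proof (induction j rule: less_induct)
    case (less j)
    have lt: "one_pos a j < one_pos a k"
      using less.prems strict_mono_less[OF strict_mono_one_pos] by blast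
    have IH: "\<forall>i<j. one_pos a i = one_pos b i" using less by simp
    have "\<not> one_pos a j < one_pos b j"
      using not_before[of a j b] ran[OF lt] IH by blast
    \<comment> \<open>Here \<open>ran\<close> applies because the inequality to be refuted puts
      \<open>one_pos b j\<close> below \<open>one_pos a k\<close>.\<close>
    moreover have "\<not> one_pos b j < one_pos a j"
      using not_before[of b j a] ran[of "one_pos b j"] lt IH by auto
    ultimately show ?case by linarith
  qed
  then show ?thesis using one_pos_eqD assms(2) by blast
qed

lemma inj_block_code: "inj block_code"
  by (intro injI ext) (metis block_code_eqD lessI)

lemma range_block_code:
  assumes "x \<in> cantor_set" "infinite {n. x n = 1}"
  shows "x \<in> range block_code"
proof -
  define e where "e = enumerate {n. x n = 1}"
  \<comment> \<open>The zeros between consecutive ones; \<open>Suc\<close> skips the one at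
    \<open>e i\<close> itself. The subtraction never truncates, since \<open>e\<close> is strictly
    increasing.\<close>
  define a where "a j = (case j of 0 \<Rightarrow> e 0 | Suc i \<Rightarrow> e (Suc i) - Suc (e i))" for j
  have "one_pos a j = e j" for j
  proof (induction j)
    case 0
    then show ?case by (simp add: one_pos_def a_def)
  next
    case (Suc j)
    have "e j < e (Suc j)"
      using enumerate_step[OF assms(2)] by (simp add: e_def)
    then show ?case using Suc by (simp add: one_pos_def a_def)
  qed
  then have "range (one_pos a) = {n. x n = 1}"
    using range_enumerate[OF assms(2)] by (simp add: e_def)
  then have "x = block_code a"
    using assms(1) by (fastforce simp: block_code_def cantor_set_def)
  then show ?thesis by blast
qed

text \<open>A point outside the range has only finitely many ones and is determined by their set,
  and there are countably many finite sets of naturals.\<close>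

lemma countable_cantor_diff_range_block_code: "countable (cantor_set - range block_code)"
proof -
  have "inj_on (\<lambda>x. {n. x n = 1}) cantor_set"
  proof (rule inj_onI, rule ext)
    fix x y :: "nat \<Rightarrow> nat" and n
    assume "x \<in> cantor_set" "y \<in> cantor_set" "{n. x n = 1} = {n. y n = 1}"
    then have "x n = 0 \<or> x n = 1" "y n = 0 \<or> y n = 1" "x n = 1 \<longleftrightarrow> y n = 1"
      by (auto simp: cantor_set_def)
    then show "x n = y n" by auto
  qed
  then have "inj_on (\<lambda>x. {n. x n = 1}) (cantor_set - range block_code)"
    by (rule inj_on_subset) blast
  moreover have "countable ((\<lambda>x. {n. x n = 1}) ` (cantor_set - range block_code))"
    by (rule countable_subset[OF _ countable_Collect_finite]) (use range_block_code in auto)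
  ultimately show ?thesis
    by (rule countable_image_inj_on[rotated])
qed

lemma aleph1_dense_vimage_block_code:
  assumes "aleph1_dense cantor_topology B"
  shows "aleph1_dense baire_topology (block_code -` B)"
  unfolding aleph1_dense_iff[of baire_topology, unfolded topspace_baire_topology, simplified]
proof (intro conjI allI impI)
  note B = assms[unfolded aleph1_dense_iff[of cantor_topology,
        unfolded topspace_cantor_topology, OF cantor_set_nonempty]]
  have "|block_code -` B| \<le>o |B|"
    by (intro card_of_ordLeqI[of block_code] inj_on_subset[OF inj_block_code]) auto
  then show "|block_code -` B| \<le>o cardSuc natLeq"
    using B ordLeq_transitive by blast
  fix U assume U: "openin baire_topology U \<and> U \<noteq> {}"
  then obtain a where "a \<in> U" by blast
  then obtain k where k: "{y. \<forall>i<k. a i = y i} \<subseteq> U"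
    using U openin_baire_cylinder by blast
  \<comment> \<open>This length makes every code in \<open>V\<close> decode to a sequence agreeing
    with \<open>a\<close> below \<open>k\<close>, hence to a point of \<open>U\<close>. Points of
    \<open>V\<close> that are not codes form a countable set.\<close>
  define V where "V = {y \<in> cantor_set. \<forall>i < one_pos a k. block_code a i = y i}"
  have "openin cantor_topology V" "block_code a \<in> V"
    by (auto simp: V_def openin_cantor_cylinder block_code_in_cantor_set)
  then have unc: "uncountable (B \<inter> V)" using B by blast
  have "B \<inter> V \<subseteq> block_code ` (block_code -` B \<inter> U) \<union> (cantor_set - range block_code)"
  proof
    fix y assume y: "y \<in> B \<inter> V"
    show "y \<in> block_code ` (block_code -` B \<inter> U) \<union> (cantor_set - range block_code)"
    proof (cases "y \<in> range block_code")
      case True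
      then obtain b where b: "y = block_code b" by blast
      then have "\<forall>j<k. a j = b j"
        using y block_code_eqD[of a k b] by (simp add: V_def)
      then have "b \<in> U" using k by blast
      then show ?thesis using b y by simp
    next
      case False
      then show ?thesis using y by (simp add: V_def)
    qed
  qed
  then show "uncountable (block_code -` B \<inter> U)"
    using unc countable_cantor_diff_range_block_code
    by (meson countable_Un countable_image countable_subset)
qed

theorem lemma3p7:
  shows "BA_Lip_baire \<longrightarrow> BA_Lip_cantor"
  unfolding BA_Lip_cantor_def
proof (intro impI allI, elim conjE)
  fix A B
  assume BA: BA_Lip_baire
    and A: "aleph1_dense cantor_topology A" and B: "aleph1_dense cantor_topology B"
  note dense_iff = aleph1_dense_iff[of cantor_topology,
      unfolded topspace_cantor_topology, OF cantor_set_nonempty]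
  have "openin cantor_topology cantor_set"
    using openin_topspace[of cantor_topology] by (simp add: topspace_cantor_topology)
  then have "uncountable (A \<inter> cantor_set)"
    using A cantor_set_nonempty unfolding dense_iff by blast
  then have unc: "uncountable A" by blast
  moreover have Ac: "|A| \<le>o cardSuc natLeq" and Bc: "B \<subseteq> cantor_set"
    using A[unfolded dense_iff] B[unfolded dense_iff] by simp_all
  ultimately have "aleph1_dense baire_topology (\<Union>s. prepend s ` A)"
    by (simp add: aleph1_dense_prepend)
  then obtain g where g: "lipschitz1_on UNIV g"
      "bij_betw g (\<Union>s. prepend s ` A) (block_code -` B)"
    using BA aleph1_dense_vimage_block_code[OF B]
    unfolding BA_Lip_baire_def by metis
  define h where "h s x = block_code (g (prepend s x))" for s x
  define C where "C = B - range block_code"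
  define F where "F = range h \<union> (\<lambda>c x. c) ` C"
  have "countable C"
    unfolding C_def
    by (rule countable_subset[OF _ countable_cantor_diff_range_block_code]) (use Bc in auto)
  then have F: "countable F" "F \<noteq> {}" by (auto simp: F_def)
  have "lipschitz1_on cantor_set (\<lambda>x. g (prepend s x))" for s
    by (rule lipschitz1_on_compose[OF lipschitz1_on_prepend subset_UNIV g(1)])
  then have "lipschitz1_on cantor_set (h s)" for s
    unfolding h_def
    by (rule lipschitz1_on_compose[OF _ subset_UNIV lipschitz1_on_block_code])
  moreover have "h s \<in> cantor_set \<rightarrow> cantor_set" for s
    by (simp add: h_def block_code_in_cantor_set)
  moreover have "(\<lambda>x. c) \<in> cantor_set \<rightarrow> cantor_set" if "c \<in> C" for c
    using that Bc by (auto simp: C_def)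
  moreover have "lipschitz1_on cantor_set (\<lambda>x. c)" for c
    by (simp add: lipschitz1_on_def)
  ultimately have "f \<in> cantor_set \<rightarrow> cantor_set \<and> lipschitz1_on cantor_set f" if "f \<in> F" for f
    using that unfolding F_def by blast
  moreover have "(\<Union>f\<in>F. f ` A) = B"
  proof -
    have "(\<Union>s. h s ` A) = block_code ` g ` (\<Union>s. prepend s ` A)"
      by (auto simp: h_def)
    also have "\<dots> = B \<inter> range block_code"
      using bij_betw_imp_surj_on[OF g(2)] by auto
    finally have h: "(\<Union>s. h s ` A) = B \<inter> range block_code" .
    \<comment> \<open>Non-emptiness makes the image of \<open>A\<close> under the constant map
      \<open>c\<close> equal to \<open>{c}\<close> rather than empty.\<close>
    have "A \<noteq> {}" using unc by auto
    then have "(\<Union>f\<in>F. f ` A) = (\<Union>s. h s ` A) \<union> C"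
      by (auto simp: F_def)
    then show ?thesis using h by (auto simp: C_def)
  qed
  \<comment> \<open>As \<open>F\<close> is countable and non-empty, \<open>from_nat_into F\<close>
    lists exactly its members, which turns \<open>F\<close> into a sequence of maps.\<close>
  moreover have "(\<Union>n. from_nat_into F n ` A) = (\<Union>f\<in>F. f ` A)"
    using arg_cong[OF range_from_nat_into[OF F(2,1)], where f = "\<lambda>G. \<Union>f\<in>G. f ` A"]
    by (simp only: image_image)
  ultimately have "(\<forall>n. from_nat_into F n \<in> cantor_set \<rightarrow> cantor_set \<and>
        lipschitz1_on cantor_set (from_nat_into F n)) \<and> B = (\<Union>n. from_nat_into F n ` A)"
    using from_nat_into[OF F(2)] by simp
  then show "\<exists>f :: nat \<Rightarrow> (nat \<Rightarrow> nat) \<Rightarrow> (nat \<Rightarrow> nat).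
      (\<forall>n. f n \<in> cantor_set \<rightarrow> cantor_set \<and> lipschitz1_on cantor_set (f n)) \<and>
      B = (\<Union>n. f n ` A)"
    by (rule exI[of _ "from_nat_into F"])
qed

end
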